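(* For any point $q_1\in I^+(q_0)$, the trajectory $q(t)=\operatorname{Exp}(\psi,c,t)$, $t\in[0,t_1]$, where $(\psi,c,t_1)=\operatorname{Exp}^{-1}(q_1)\in N$, is the unique optimal trajectory, connecting $q_0$ with $q_1$, of the reduced sub-Lorentzian problem in its time-maximal form: \begin{align*} &\dot q=u_1X_1(q)+u_2X_2(q),\qquad q\in M,\\ &u_1^2-u_2^2=1,\qquad u_1>0,\\ &q(0)=q_0,\qquad q(t_1)=q_1,\\ &t_1\to\max . \end{align*}
   Context: $M=\mathbb R^3_{x,y,z}$ is the Heisenberg group with product $(x_1,y_1,z_1)\cdot(x_2,y_2,z_2)=(x_1+x_2,\,y_1+y_2,\,z_1+z_2+(x_1y_2-x_2y_1)/2)$, $q_0=(0,0,0)$ is the identity, and $X_1=\frac{\partial}{\partial x}-\frac y2\frac{\partial}{\partial z}$, $X_2=\frac{\partial}{\partial y}+\frac x2\frac{\partial}{\partial z}$ are left-invariant vector fields. Trajectories are Lipschitz curves satisfying the control system for a.e. $t$; the terminal time $t_1$ is free. $I^+(q_0)$ is the chronological future of $q_0$ (the set of points reachable from $q_0$ in positive time by trajectories of $\dot q=u_1X_1+u_2X_2$ with $u_1>|u_2|$); it is known that $I^+(q_0)=\{(x,y,z)\mid -x^2+y^2+4|z|<0,\ x>0\}$. The exponential mapping $\operatorname{Exp}:N\to I^+(q_0)$, $N=\mathbb R^2_{\psi,c}\times(0,+\infty)_t$, is $\operatorname{Exp}(\psi,c,t)=(x,y,z)$ with: if $c=0$, $x=t\cosh\psi$,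 $y=t\sinh\psi$, $z=0$; if $c\neq0$, $x=\frac{\sinh(\psi+ct)-\sinh\psi}{c}$, $y=\frac{\cosh(\psi+ct)-\cosh\psi}{c}$, $z=\frac{\sinh(ct)-ct}{2c^2}$. It is a diffeomorphism of $N$ onto $I^+(q_0)$. By the same formulas one sets $\operatorname{Exp}(\psi,c,0)=q_0$. *)

theory Defs
  imports "HOL-Analysis.Analysis"
begin

type_synonym point = "real \<times> real \<times> real"

definition q0 :: point where
  "q0 = (0, 0, 0)"

definition X1 :: "point \<Rightarrow> point" where
  "X1 = (\<lambda>(x, y, z). (1, 0, - y / 2))"

definition X2 :: "point \<Rightarrow> point" where
  "X2 = (\<lambda>(x, y, z). (0, 1, x / 2))"

(* Measurability and boundedness of the controls are not demanded separately: almost everywhere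
   (u1, u2) is the derivative of the first two components of the Lipschitz curve q.
   Only the values of q on {0..T} matter. *)
definition trajectory :: "(real \<times> real) set \<Rightarrow> real \<Rightarrow> (real \<Rightarrow> point) \<Rightarrow> bool" where
  "trajectory U T q \<longleftrightarrow>
     (\<exists>L. L-lipschitz_on {0..T} q) \<and>
     (\<exists>u1 u2. AE t in lebesgue_on {0..T}.
        (u1 t, u2 t) \<in> U \<and>
        (q has_vector_derivative (u1 t *\<^sub>R X1 (q t) + u2 t *\<^sub>R X2 (q t))) (at t within {0..T}))"

definition chronological_future :: "point \<Rightarrow> point set" where
  "chronological_future p =
     {p'. \<exists>T q. 0 < T \<and> trajectory {(u1, u2). u1 > \<bar>u2\<bar>} T q \<and> q 0 = p \<and> q T = p'}"

definition Exp_dom :: "(real \<times> real \<times> real) set" where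
  "Exp_dom = UNIV \<times> UNIV \<times> {0<..}"

definition Exp :: "real \<times> real \<times> real \<Rightarrow> point" where
  "Exp = (\<lambda>(\<psi>, c, t).
     if c = 0 then (t * cosh \<psi>, t * sinh \<psi>, 0)
     else ((sinh (\<psi> + c * t) - sinh \<psi>) / c,
           (cosh (\<psi> + c * t) - cosh \<psi>) / c,
           (sinh (c * t) - c * t) / (2 * c\<^sup>2)))"

(* The terminal time T is free, so an admissible trajectory is the pair of T and the curve q. *)
definition admissible :: "point \<Rightarrow> real \<Rightarrow> (real \<Rightarrow> point) \<Rightarrow> bool" where
  "admissible q1 T q \<longleftrightarrow>
     0 \<le> T \<and> trajectory {(u1, u2). u1\<^sup>2 - u2\<^sup>2 = 1 \<and> u1 > 0} T q \<and> q 0 = q0 \<and> q T = q1"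

definition optimal :: "point \<Rightarrow> real \<Rightarrow> (real \<Rightarrow> point) \<Rightarrow> bool" where
  "optimal q1 T q \<longleftrightarrow>
     admissible q1 T q \<and> (\<forall>T' q'. admissible q1 T' q' \<longrightarrow> T' \<le> T)"

end

theory Submission
  imports Defs "HOL-Real_Asymp.Real_Asymp"
begin

text \<open>
  Optimality and uniqueness come from a calibration. The projection of an extremal to the
  \<open>(x, y)\<close>-plane is a graph over the \<open>x\<close>-axis, and its translates in the \<open>y\<close>-direction fill the
  plane; the field of their velocities is \<open>(sqrt (1 + w\<^sup>2), w)\<close> with \<open>w = sinh \<psi> + c x\<close>. Along an
  admissible trajectory the 1-form \<open>sqrt (1 + w\<^sup>2) dx - w dy\<close> is at least \<open>dt\<close>, by the reverse
  Cauchy--Schwarz inequality, with equality only for velocities in the field. Its integral depends only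
  on the endpoint, because \<open>x dy = d (z + x y / 2)\<close> along horizontal curves; hence the bound on the
  time. In the equality case \<open>arsinh w\<close> has derivative \<open>c\<close> almost everywhere, so
  \<open>w = sinh (\<psi> + c t)\<close>, which determines the curve.

  Every point of the chronological future is a value of \<open>Exp\<close>: in the future, \<open>x\<^sup>2 - y\<^sup>2 - 4 z\<close> and
  \<open>x\<^sup>2 - y\<^sup>2 + 4 z\<close> increase strictly from 0, and \<open>Exp (\<psi>, c, t) = (x, y, z)\<close> reduces to
  one scalar equation for \<open>c t / 2\<close>, solved by the intermediate value theorem.
\<close>

subsection \<open>Lipschitz functions and derivatives almost everywhere\<close>

lemma AE_lebesgue_on_imp_negligible:
  assumes "AE t in lebesgue_on S. P t" "S \<in> sets lebesgue"
  shows "negligible {t \<in> S. \<not> P t}"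
proof -
  obtain N where N: "{t \<in> space (lebesgue_on S). \<not> P t} \<subseteq> N" "N \<in> null_sets (lebesgue_on S)"
    using AE_E[OF assms(1)] by (metis null_setsI)
  then have "N \<in> null_sets lebesgue"
    using null_sets_restrict_space[OF assms(2)] by auto
  moreover have "{t \<in> S. \<not> P t} \<subseteq> N" using N by simp
  ultimately show ?thesis
    using negligible_iff_null_sets negligible_subset by blast
qed

text \<open>
  An open set \<open>U\<close> of measure at most \<open>e\<close> covers the exceptional null set, where a possible decrease of
  \<open>f\<close> is paid for by \<open>L\<close> times the measure of \<open>U\<close>; elsewhere the slope is at least \<open>-e\<close>
  locally. Both estimates are additive over adjacent intervals, so bisection makes them global.
\<close>

lemma lipschitz_AE_nonneg_derivative_imp_mono:
  fixes f :: "real \<Rightarrow> real"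
  assumes lip: "L-lipschitz_on {a..b} f"
    and deriv: "AE t in lebesgue_on {a..b}. \<exists>d\<ge>0. (f has_real_derivative d) (at t within {a..b})"
  shows "mono_on {a..b} f"
proof (rule mono_onI)
  fix s t assume st: "s \<in> {a..b}" "t \<in> {a..b}" "s \<le> t"
  define N where "N = {t \<in> {a..b}. \<not> (\<exists>d\<ge>0. (f has_real_derivative d) (at t within {a..b}))}"
  have neg: "negligible N"
    unfolding N_def by (rule AE_lebesgue_on_imp_negligible[OF deriv]) simp
  have L0: "0 \<le> L" using lip by (rule lipschitz_on_nonneg)
  have key: "f s \<le> f t + e * (t - s + L)" if e: "e > 0" for e
  proof -
    have N_leb: "N \<in> sets lebesgue"
      using neg negligible_imp_sets by blast
    obtain U where U: "open U" "N \<subseteq> U" "U - N \<in> lmeasurable" "emeasure lebesgue (U - N) < ennreal e"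
      using sets_lebesgue_outer_open[OF N_leb e] by metis
    have N0: "N \<in> lmeasurable" "measure lebesgue N = 0"
      using neg negligible_imp_measurable negligible_imp_measure0 by blast+
    have Ueq: "U = (U - N) \<union> N" using U by auto
    have Um: "U \<in> lmeasurable" using U N0 Ueq by (metis fmeasurable.Un)
    have "measure lebesgue (U - N) \<le> e"
      using U(4) e by (simp add: emeasure_eq_measure2[OF U(3)] ennreal_less_iff)
    moreover have "measure lebesgue U \<le> measure lebesgue (U - N) + measure lebesgue N"
      using Ueq U N0 by (metis fmeasurableD measure_Un_le)
    ultimately have Ue: "measure lebesgue U \<le> e" using N0 by simp
    \<comment> \<open>Half-open intervals make \<open>m\<close> exactly additive under
      bisection.\<close>
    define m where "m u v = measure lebesgue (U \<inter> {u<..v})" for u v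
    have mm: "U \<inter> {u<..v} \<in> lmeasurable" for u v
      using Um by (intro fmeasurable_Int_fmeasurable) auto
    have m_add: "m u v + m v w = m u w" if "u \<le> v" "v \<le> w" for u v w
    proof -
      have "U \<inter> {u<..w} = (U \<inter> {u<..v}) \<union> (U \<inter> {v<..w})" using that by auto
      moreover have "(U \<inter> {u<..v}) \<inter> (U \<inter> {v<..w}) = {}" by auto
      ultimately show ?thesis unfolding m_def
        using measure_Un3[OF mm mm, of u v v w] by simp
    qed
    define P where "P u v \<longleftrightarrow> (a \<le> u \<longrightarrow> u \<le> v \<longrightarrow> v \<le> b \<longrightarrow> f u \<le> f v + e * (v - u) + L * m u v)" for u v
    have "P s t"
    proof (rule Bolzano[OF st(3)])
      fix u v w assume *: "P u v" "P v w" "u \<le> v" "v \<le> w"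
      then show "P u w" using m_add[OF *(3,4)] unfolding P_def
        by (auto simp: algebra_simps simp flip: m_add[OF *(3,4)])
    next
      fix x assume x: "s \<le> x" "x \<le> t"
      then have xab: "x \<in> {a..b}" using st by auto
      show "\<exists>d>0. \<forall>u v. u \<le> x \<and> x \<le> v \<and> v - u < d \<longrightarrow> P u v"
      proof (cases "x \<in> N")
        case True
        then obtain d where d: "d > 0" "ball x d \<subseteq> U" using U openE by blast
        have "P u v" if uv: "u \<le> x" "x \<le> v" "v - u < d" for u v
          unfolding P_def
        proof (intro impI)
          assume "a \<le> u" "u \<le> v" "v \<le> b"
          \<comment> \<open>Near a point of \<open>N\<close> the whole interval lies in
            \<open>U\<close>, so the term \<open>L * m u v\<close> absorbs the largest decrease that
            the Lipschitz bound permits.\<close>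
          have "U \<inter> {u<..v} = {u<..v}" using d uv by (auto simp: subset_iff dist_real_def)
          then have "m u v = v - u" using \<open>u \<le> v\<close> by (simp add: m_def)
          moreover have "\<bar>f u - f v\<bar> \<le> L * \<bar>u - v\<bar>"
            using lipschitz_onD[OF lip, of u v] \<open>a \<le> u\<close> \<open>u \<le> v\<close> \<open>v \<le> b\<close> by (simp add: dist_real_def)
          ultimately show "f u \<le> f v + e * (v - u) + L * m u v"
            using e \<open>u \<le> v\<close> by (smt (verit) mult_nonneg_nonneg)
        qed
        then show ?thesis using d by blast
      next
        case False
        then obtain D where D: "D \<ge> 0" "(f has_real_derivative D) (at x within {a..b})"
          using xab N_def by auto
        then obtain d where d: "d > 0"
          "\<And>y. y \<in> {a..b} \<Longrightarrow> \<bar>y - x\<bar> < d \<Longrightarrow> \<bar>f y - f x - D * (y - x)\<bar> \<le> e * \<bar>y - x\<bar>"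
          using e unfolding has_field_derivative_def has_derivative_within_alt
          by (fastforce simp: real_norm_def)
        have "P u v" if uv: "u \<le> x" "x \<le> v" "v - u < d" for u v
          unfolding P_def
        proof (intro impI)
          assume "a \<le> u" "u \<le> v" "v \<le> b"
          \<comment> \<open>As \<open>x\<close> lies between \<open>u\<close> and \<open>v\<close>,
            the linear terms at both ends have the favourable sign, and the two remainders add up to
            exactly \<open>e * (v - u)\<close>.\<close>
          have "\<bar>f u - f x - D * (u - x)\<bar> \<le> e * (x - u)"
            using d(2)[of u] uv \<open>a \<le> u\<close> \<open>u \<le> v\<close> \<open>v \<le> b\<close> by auto
          moreover have "\<bar>f v - f x - D * (v - x)\<bar> \<le> e * (v - x)"
            using d(2)[of v] uv \<open>a \<le> u\<close> \<open>u \<le> v\<close> \<open>v \<le> b\<close> by auto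
          moreover have "D * (u - x) \<le> 0" "0 \<le> D * (v - x)"
            using D uv by (auto simp: mult_nonneg_nonpos)
          moreover have "0 \<le> L * m u v" using L0 by (simp add: m_def)
          moreover have "e * (x - u) + e * (v - x) = e * (v - u)" by (simp add: algebra_simps)
          ultimately show "f u \<le> f v + e * (v - u) + L * m u v" by linarith
        qed
        then show ?thesis using d by blast
      qed
    qed
    then have "f s \<le> f t + e * (t - s) + L * m s t" using st by (simp add: P_def)
    moreover have "m s t \<le> e"
      using measure_mono_fmeasurable[of "U \<inter> {s<..t}" U lebesgue] mm[of s t] Um Ue unfolding m_def by fastforce
    ultimately show ?thesis using L0 mult_left_mono[of "m s t" e L] by (simp add: algebra_simps)
  qed
  show "f s \<le> f t"
  proof (rule field_le_epsilon)
    fix \<epsilon> :: real assume "\<epsilon> > 0"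
    define K where "K = t - s + L + 1"
    have K: "K > 0" "t - s + L \<le> K" using st L0 by (auto simp: K_def)
    have "f s \<le> f t + \<epsilon> / K * (t - s + L)" using key[of "\<epsilon> / K"] K \<open>\<epsilon> > 0\<close> by simp
    also have "\<dots> \<le> f t + \<epsilon> / K * K" using K \<open>\<epsilon> > 0\<close> by (intro add_left_mono mult_left_mono) auto
    finally show "f s \<le> f t + \<epsilon>" using K by simp
  qed
qed

lemma real_derivative_unique_within_closed_interval:
  fixes f :: "real \<Rightarrow> real"
  assumes "a < b" "t \<in> {a..b}"
    and "(f has_real_derivative d) (at t within {a..b})" "(f has_real_derivative d') (at t within {a..b})"
  shows "d = d'"
  using vector_derivative_unique_within_closed_interval[of a b t f d d'] assms
  by (simp add: has_real_derivative_iff_has_vector_derivative)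

text \<open>Monotonicity squeezes every value between the equal end values. This turns equality of
  end values into information on derivatives, both for strict monotonicity and for the equality case
  of the calibration.\<close>

lemma mono_on_eq_ends_derivative_zero:
  fixes f :: "real \<Rightarrow> real"
  assumes "mono_on {a..b} f" "f a = f b" "a < b" "t \<in> {a..b}"
    and "(f has_real_derivative d) (at t within {a..b})"
  shows "d = 0"
proof -
  have const: "f s = f a" if "s \<in> {a..b}" for s
    using mono_onD[OF assms(1), of a s] mono_onD[OF assms(1), of s b] that assms(2) by auto
  have "(f has_real_derivative 0) (at t within {a..b})"
    by (rule has_field_derivative_transform_within[OF DERIV_const zero_less_one assms(4) const[symmetric]])
  then show ?thesis
    using real_derivative_unique_within_closed_interval assms by blast
qed

text \<open>If \<open>f s = f t\<close> with \<open>s < t\<close>, then \<open>f\<close> is constant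
  on \<open>{s..t}\<close>; this interval is not negligible, so it contains a point where the
  derivative is positive, a contradiction.\<close>

lemma lipschitz_AE_pos_derivative_imp_strict_mono:
  fixes f :: "real \<Rightarrow> real"
  assumes lip: "L-lipschitz_on {a..b} f"
    and deriv: "AE t in lebesgue_on {a..b}. \<exists>d>0. (f has_real_derivative d) (at t within {a..b})"
  shows "strict_mono_on {a..b} f"
proof (rule strict_mono_onI)
  fix s t assume st: "s \<in> {a..b}" "t \<in> {a..b}" "s < t"
  have mono: "mono_on {a..b} f"
    using lip by (rule lipschitz_AE_nonneg_derivative_imp_mono)
      (rule eventually_mono[OF deriv], auto intro: less_imp_le)
  have "negligible {t \<in> {a..b}. \<not> (\<exists>d>0. (f has_real_derivative d) (at t within {a..b}))}"
    by (rule AE_lebesgue_on_imp_negligible[OF deriv]) simp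
  moreover have "\<not> negligible {s..t}" using st negligible_interval(1)[of s t] by (simp add: box_real)
  ultimately obtain p where p: "p \<in> {s..t}"
      "p \<notin> {t \<in> {a..b}. \<not> (\<exists>d>0. (f has_real_derivative d) (at t within {a..b}))}"
    by (meson negligible_subset subsetI)
  then obtain d where d: "d > 0" "(f has_real_derivative d) (at p within {a..b})"
    using st by auto
  have sub: "{s..t} \<subseteq> {a..b}" using st by auto
  have "f s \<noteq> f t"
    using mono_on_eq_ends_derivative_zero[OF mono_on_subset[OF mono sub] _ st(3) p(1)
      DERIV_subset[OF d(2) sub]] d by auto
  with mono_onD[OF mono, of s t] st show "f s < f t" by auto
qed

text \<open>Both \<open>f - g\<close> and \<open>g - f\<close> have derivative 0 almost everywhere,
  so both are monotone and the difference keeps its initial value. This is how a curve is recovered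
  from its velocity.\<close>

lemma lipschitz_AE_eq_derivative_imp_eq:
  fixes f g :: "real \<Rightarrow> real"
  assumes "L-lipschitz_on {a..b} f" "M-lipschitz_on {a..b} g" "f a = g a"
    and deriv: "AE t in lebesgue_on {a..b}. \<exists>d. (f has_real_derivative d) (at t within {a..b}) \<and>
      (g has_real_derivative d) (at t within {a..b})"
    and t: "t \<in> {a..b}"
  shows "f t = g t"
proof -
  have "mono_on {a..b} (\<lambda>t. f t - g t)"
    using lipschitz_on_diff[OF assms(1,2)]
    by (rule lipschitz_AE_nonneg_derivative_imp_mono)
      (rule eventually_mono[OF deriv], force intro!: exI[where x=0] derivative_eq_intros)
  moreover have "mono_on {a..b} (\<lambda>t. g t - f t)"
    using lipschitz_on_diff[OF assms(2,1)]
    by (rule lipschitz_AE_nonneg_derivative_imp_mono)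
      (rule eventually_mono[OF deriv], force intro!: exI[where x=0] derivative_eq_intros)
  ultimately show ?thesis
    using mono_onD[of "{a..b}" _ a t] assms(3) t by (smt (verit) atLeastAtMost_iff)
qed

section \<open>Lipschitz bounds for products, C1 functions and compositions\<close>

lemma lipschitz_on_mult_compact:
  fixes f g :: "real \<Rightarrow> real"
  assumes "\<exists>L. L-lipschitz_on S f" "\<exists>L. L-lipschitz_on S g" "compact S"
  shows "\<exists>L. L-lipschitz_on S (\<lambda>t. f t * g t)"
proof -
  obtain L M where LM: "L-lipschitz_on S f" "M-lipschitz_on S g" using assms by auto
  have "bounded (f ` S)" "bounded (g ` S)"
    using LM assms(3) by (meson lipschitz_on_continuous_on compact_continuous_image compact_imp_bounded)+
  then obtain A B where AB: "\<And>t. t \<in> S \<Longrightarrow> \<bar>f t\<bar> \<le> A" "\<And>t. t \<in> S \<Longrightarrow> \<bar>g t\<bar> \<le> B" "0 < A" "0 < B"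
    unfolding bounded_pos by (auto simp: real_norm_def)
  have L0: "0 \<le> L" "0 \<le> M" using LM lipschitz_on_nonneg by auto
  have "(A * M + B * L)-lipschitz_on S (\<lambda>t. f t * g t)"
  proof (rule lipschitz_onI)
    fix s t assume st: "s \<in> S" "t \<in> S"
    have "\<bar>f s * g s - f t * g t\<bar> \<le> \<bar>f s\<bar> * \<bar>g s - g t\<bar> + \<bar>g t\<bar> * \<bar>f s - f t\<bar>"
      by (simp flip: abs_mult) (smt (verit) right_diff_distrib mult.commute)
    also have "\<dots> \<le> A * (M * \<bar>s - t\<bar>) + B * (L * \<bar>s - t\<bar>)"
      using AB L0 st lipschitz_onD[OF LM(1) st] lipschitz_onD[OF LM(2) st]
      by (intro add_mono mult_mono) (auto simp: dist_real_def)
    finally show "dist (f s * g s) (f t * g t) \<le> (A * M + B * L) * dist s t"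
      by (simp add: dist_real_def algebra_simps)
  qed (use AB L0 in auto)
  then show ?thesis by blast
qed

lemma C1_imp_lipschitz_on_interval:
  fixes f :: "real \<Rightarrow> 'a::real_normed_vector"
  assumes "\<And>t. t \<in> {a..b} \<Longrightarrow> (f has_vector_derivative f' t) (at t within {a..b})"
    and "continuous_on {a..b} f'"
  shows "\<exists>L. L-lipschitz_on {a..b} f"
proof -
  have "bounded (f' ` {a..b})"
    using assms(2) compact_continuous_image compact_imp_bounded compact_Icc by blast
  then obtain B where B: "0 < B" "\<And>t. t \<in> {a..b} \<Longrightarrow> norm (f' t) \<le> B"
    unfolding bounded_pos by auto
  have "B-lipschitz_on {a..b} f"
  proof (rule bounded_derivative_imp_lipschitz)
    show "(f has_derivative (\<lambda>h. h *\<^sub>R f' t)) (at t within {a..b})" if "t \<in> {a..b}" for t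
      using assms(1)[OF that] by (simp add: has_vector_derivative_def)
    show "onorm (\<lambda>h. h *\<^sub>R f' t) \<le> B" if "t \<in> {a..b}" for t
      by (rule onorm_le) (auto simp: mult.commute[of B] intro!: mult_left_mono B(2) that)
  qed (use B in auto)
  then show ?thesis by blast
qed

lemma DERIV_continuous_imp_lipschitz_on_interval:
  fixes f :: "real \<Rightarrow> real"
  assumes "\<And>t. (f has_real_derivative f' t) (at t)" "continuous_on {a..b} f'"
  shows "\<exists>L. L-lipschitz_on {a..b} f"
  using assms(2)
  by (rule C1_imp_lipschitz_on_interval[rotated])
    (use assms(1) has_field_derivative_at_within has_real_derivative_iff_has_vector_derivative in blast)

lemma lipschitz_on_C1_compose:
  fixes f F :: "real \<Rightarrow> real"
  assumes "\<exists>L. L-lipschitz_on S f" "compact S"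
    and F: "\<And>x. (F has_real_derivative F' x) (at x)" "continuous_on UNIV F'"
  shows "\<exists>L. L-lipschitz_on S (\<lambda>t. F (f t))"
proof -
  obtain L where L: "L-lipschitz_on S f" using assms by auto
  have "bounded (f ` S)"
    using L assms(2) by (meson lipschitz_on_continuous_on compact_continuous_image compact_imp_bounded)
  then obtain A where A: "f ` S \<subseteq> {-A..A}" unfolding bounded_pos by (force simp: abs_le_iff)
  have "\<exists>M. M-lipschitz_on {-A..A} F"
    using F(2) by (intro DERIV_continuous_imp_lipschitz_on_interval[OF F(1)]) (rule continuous_on_subset, auto)
  then obtain M where "M-lipschitz_on {-A..A} F" by blast
  then show ?thesis
    using lipschitz_on_compose2[OF L] lipschitz_on_subset A by blast
qed

subsection \<open>The chronological future\<close>

text \<open>Reads the control system by coordinates: projections do not increase distances, and the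
  last component of \<open>u1 X1 + u2 X2\<close> is the horizontality condition for
  \<open>z\<close>.\<close>

lemma trajectoryE:
  assumes "trajectory U T q"
  obtains x y z u1 u2 :: "real \<Rightarrow> real"
  where "\<And>t. q t = (x t, y t, z t)"
    and "\<exists>L. L-lipschitz_on {0..T} x" "\<exists>L. L-lipschitz_on {0..T} y" "\<exists>L. L-lipschitz_on {0..T} z"
    and "AE t in lebesgue_on {0..T}. (u1 t, u2 t) \<in> U \<and>
      (x has_real_derivative u1 t) (at t within {0..T}) \<and>
      (y has_real_derivative u2 t) (at t within {0..T}) \<and>
      (z has_real_derivative (x t * u2 t - y t * u1 t) / 2) (at t within {0..T})"
proof -
  obtain L u1 u2 where L: "L-lipschitz_on {0..T} q" and ae: "AE t in lebesgue_on {0..T}. (u1 t, u2 t) \<in> U \<and>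
      (q has_vector_derivative (u1 t *\<^sub>R X1 (q t) + u2 t *\<^sub>R X2 (q t))) (at t within {0..T})"
    using assms unfolding trajectory_def by auto
  define x y z where "x t = fst (q t)" and "y t = fst (snd (q t))" and "z t = snd (snd (q t))" for t
  have q: "q t = (x t, y t, z t)" for t by (simp add: x_def y_def z_def)
  have "dist (x s) (x t) \<le> dist (q s) (q t)" "dist (y s) (y t) \<le> dist (q s) (q t)"
    "dist (z s) (z t) \<le> dist (q s) (q t)" for s t
    unfolding x_def y_def z_def by (meson dist_fst_le dist_snd_le order_trans)+
  then have lips: "L-lipschitz_on {0..T} x" "L-lipschitz_on {0..T} y" "L-lipschitz_on {0..T} z"
    using L unfolding lipschitz_on_def by (meson order_trans)+
  have "(x has_real_derivative v1) (at t within {0..T}) \<and>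
      (y has_real_derivative v2) (at t within {0..T}) \<and>
      (z has_real_derivative (x t * v2 - y t * v1) / 2) (at t within {0..T})"
    if "(q has_vector_derivative (v1 *\<^sub>R X1 (q t) + v2 *\<^sub>R X2 (q t))) (at t within {0..T})" for t v1 v2
  proof -
    have "v1 *\<^sub>R X1 (q t) + v2 *\<^sub>R X2 (q t) = (v1, v2, (x t * v2 - y t * v1) / 2)"
      by (simp add: q X1_def X2_def field_simps)
    with that have d: "(q has_vector_derivative (v1, v2, (x t * v2 - y t * v1) / 2)) (at t within {0..T})"
      by simp
    note ds = bounded_linear.has_vector_derivative[OF bounded_linear_snd d]
    show ?thesis
      using bounded_linear.has_vector_derivative[OF bounded_linear_fst d]
        bounded_linear.has_vector_derivative[OF bounded_linear_fst ds]
        bounded_linear.has_vector_derivative[OF bounded_linear_snd ds]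
      by (simp add: has_real_derivative_iff_has_vector_derivative x_def[abs_def] y_def[abs_def] z_def[abs_def])
  qed
  with ae have "AE t in lebesgue_on {0..T}. (u1 t, u2 t) \<in> U \<and>
      (x has_real_derivative u1 t) (at t within {0..T}) \<and>
      (y has_real_derivative u2 t) (at t within {0..T}) \<and>
      (z has_real_derivative (x t * u2 t - y t * u1 t) / 2) (at t within {0..T})"
    by (elim eventually_mono) blast
  with q lips that show ?thesis by blast
qed

text \<open>In the null coordinates \<open>x + y\<close> and \<open>x - y\<close>, both of which
  increase strictly from 0, the derivative of \<open>(x + y) * (x - y) - 4 * z\<close> collapses to
  the product \<open>2 * (x + y) * (u1 - u2)\<close> of positive factors; changing the sign of
  \<open>z\<close> exchanges the roles of the two coordinates.\<close>

lemma chronological_future_q0_subset: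
  assumes "(x1, y1, z1) \<in> chronological_future q0"
  shows "0 < x1 \<and> 4 * \<bar>z1\<bar> < x1\<^sup>2 - y1\<^sup>2"
proof -
  obtain T q where T: "0 < T" and tr: "trajectory {(u1, u2). u1 > \<bar>u2\<bar>} T q"
    and ends: "q 0 = q0" "q T = (x1, y1, z1)"
    using assms unfolding chronological_future_def by auto
  from tr obtain x y z u1 u2 where q: "\<And>t. q t = (x t, y t, z t)"
    and lip: "\<exists>L. L-lipschitz_on {0..T} x" "\<exists>L. L-lipschitz_on {0..T} y" "\<exists>L. L-lipschitz_on {0..T} z"
    and ae: "AE t in lebesgue_on {0..T}. (u1 t, u2 t) \<in> {(u1, u2). u1 > \<bar>u2\<bar>} \<and>
      (x has_real_derivative u1 t) (at t within {0..T}) \<and>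
      (y has_real_derivative u2 t) (at t within {0..T}) \<and>
      (z has_real_derivative (x t * u2 t - y t * u1 t) / 2) (at t within {0..T})"
    by (rule trajectoryE) blast
  have init: "x 0 = 0" "y 0 = 0" "z 0 = 0" and final: "x T = x1" "y T = y1" "z T = z1"
    using ends q by (auto simp: q0_def)
  obtain Lx Ly Lz where L: "Lx-lipschitz_on {0..T} x" "Ly-lipschitz_on {0..T} y" "Lz-lipschitz_on {0..T} z"
    using lip by blast
  have "strict_mono_on {0..T} (\<lambda>t. x t + y t)"
    using lipschitz_on_add[OF L(1,2)]
    by (rule lipschitz_AE_pos_derivative_imp_strict_mono)
      (rule eventually_mono[OF ae], force intro!: exI[where x="u1 _ + u2 _"] derivative_eq_intros)
  then have a_pos: "0 < x t + y t" if "t \<in> {0<..T}" for t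
    using strict_mono_onD[of "{0..T}" _ 0 t] that init by fastforce
  have "strict_mono_on {0..T} (\<lambda>t. x t - y t)"
    using lipschitz_on_diff[OF L(1,2)]
    by (rule lipschitz_AE_pos_derivative_imp_strict_mono)
      (rule eventually_mono[OF ae], force intro!: exI[where x="u1 _ - u2 _"] derivative_eq_intros)
  then have b_pos: "0 < x t - y t" if "t \<in> {0<..T}" for t
    using strict_mono_onD[of "{0..T}" _ 0 t] that init by fastforce
  \<comment> \<open>At time 0 the factors \<open>x + y\<close> and \<open>x - y\<close> vanish, so
    this single instant is discarded to keep the derivatives strictly positive.\<close>
  have "AE t in lebesgue. t \<noteq> (0::real)"
    by (rule AE_I'[of "{0}"]) auto
  then have "AE t in lebesgue_on {0..T}. t \<in> {0<..T}"
    by (subst AE_restrict_space_iff) auto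
  with ae have ae': "AE t in lebesgue_on {0..T}. t \<in> {0<..T} \<and> u1 t > \<bar>u2 t\<bar> \<and>
      (x has_real_derivative u1 t) (at t within {0..T}) \<and>
      (y has_real_derivative u2 t) (at t within {0..T}) \<and>
      (z has_real_derivative (x t * u2 t - y t * u1 t) / 2) (at t within {0..T})"
    by eventually_elim auto
  have "\<exists>L. L-lipschitz_on {0..T} (\<lambda>t. (x t + y t) * (x t - y t))"
    using lipschitz_on_add[OF L(1,2)] lipschitz_on_diff[OF L(1,2)]
    by (intro lipschitz_on_mult_compact) auto
  then obtain M where M: "M-lipschitz_on {0..T} (\<lambda>t. (x t + y t) * (x t - y t))" by blast
  have M4: "(\<bar>4\<bar> * Lz)-lipschitz_on {0..T} (\<lambda>t. 4 * z t)"
    using L(3) by (rule lipschitz_on_cmult_real)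
  have "strict_mono_on {0..T} (\<lambda>t. (x t + y t) * (x t - y t) - 4 * z t)"
    using lipschitz_on_diff[OF M M4]
  proof (rule lipschitz_AE_pos_derivative_imp_strict_mono)
    show "AE t in lebesgue_on {0..T}. \<exists>d>0. ((\<lambda>t. (x t + y t) * (x t - y t) - 4 * z t) has_real_derivative d) (at t within {0..T})"
      using ae'
    proof eventually_elim
      case (elim t)
      have "0 < 2 * (x t + y t) * (u1 t - u2 t)" using elim a_pos[of t] by auto
      moreover have "((\<lambda>t. (x t + y t) * (x t - y t) - 4 * z t) has_real_derivative
          2 * (x t + y t) * (u1 t - u2 t)) (at t within {0..T})"
        using elim by (auto intro!: derivative_eq_intros simp: field_simps)
      ultimately show ?case by blast
    qed
  qed
  from strict_mono_onD[OF this, of 0 T] have "4 * z1 < (x1 + y1) * (x1 - y1)"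
    using T init final by simp
  moreover have "strict_mono_on {0..T} (\<lambda>t. (x t + y t) * (x t - y t) + 4 * z t)"
    using lipschitz_on_add[OF M M4]
  proof (rule lipschitz_AE_pos_derivative_imp_strict_mono)
    show "AE t in lebesgue_on {0..T}. \<exists>d>0. ((\<lambda>t. (x t + y t) * (x t - y t) + 4 * z t) has_real_derivative d) (at t within {0..T})"
      using ae'
    proof eventually_elim
      case (elim t)
      have "0 < 2 * (x t - y t) * (u1 t + u2 t)" using elim b_pos[of t] by auto
      moreover have "((\<lambda>t. (x t + y t) * (x t - y t) + 4 * z t) has_real_derivative
          2 * (x t - y t) * (u1 t + u2 t)) (at t within {0..T})"
        using elim by (auto intro!: derivative_eq_intros simp: field_simps)
      ultimately show ?case by blast
    qed
  qed
  from strict_mono_onD[OF this, of 0 T] have "- 4 * z1 < (x1 + y1) * (x1 - y1)"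
    using T init final by simp
  moreover have "0 < x1" using a_pos[of T] b_pos[of T] T final by auto
  ultimately show ?thesis by (auto simp: power2_eq_square algebra_simps)
qed

subsection \<open>The exponential mapping\<close>

text \<open>
  With \<open>\<tau> = c t / 2\<close> one has \<open>x\<^sup>2 - y\<^sup>2 = 4 (sinh \<tau>)\<^sup>2 / c\<^sup>2\<close>, so \<open>r\<close> below is the ratio
  \<open>z / (x\<^sup>2 - y\<^sup>2)\<close>.
\<close>

lemma sinh_area_ratio_surj:
  fixes r :: real
  assumes "\<bar>r\<bar> < 1/4" "r \<noteq> 0"
  obtains \<tau> where "\<tau> \<noteq> 0" "sinh (2 * \<tau>) - 2 * \<tau> = 8 * r * (sinh \<tau>)\<^sup>2"
proof -
  define g :: "real \<Rightarrow> real" where "g \<tau> = (sinh (2 * \<tau>) - 2 * \<tau>) / (8 * (sinh \<tau>)\<^sup>2)" for \<tau>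
  \<comment> \<open>The limit 1/4 at infinity is the boundary
    \<open>4 * \<bar>z\<bar> = x\<^sup>2 - y\<^sup>2\<close> of the future, the limit 0 is the plane
    \<open>z = 0\<close>; continuity gives all the ratios strictly between.\<close>
  have lims: "(g \<longlongrightarrow> 0) (at_right 0)" "(g \<longlongrightarrow> 1/4) at_top"
    unfolding g_def by (real_asymp simp: power2_eq_square)+
  have r: "0 < \<bar>r\<bar>" using assms by simp
  have "\<forall>\<^sub>F \<tau> in at_right 0. g \<tau> < \<bar>r\<bar>"
    using order_tendstoD(2)[OF lims(1)] r by blast
  then obtain b where b: "b > 0" "\<And>\<tau>. 0 < \<tau> \<Longrightarrow> \<tau> < b \<Longrightarrow> g \<tau> < \<bar>r\<bar>"
    unfolding eventually_at_right_field by auto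
  have "\<forall>\<^sub>F \<tau> in at_top. g \<tau> > \<bar>r\<bar>"
    using order_tendstoD(1)[OF lims(2)] assms by blast
  then obtain M where M: "\<And>\<tau>. M \<le> \<tau> \<Longrightarrow> g \<tau> > \<bar>r\<bar>"
    unfolding eventually_at_top_linorder by auto
  have "\<exists>\<tau>\<ge>b/2. \<tau> \<le> max b M \<and> g \<tau> = \<bar>r\<bar>"
  proof (rule IVT')
    show "g (b/2) \<le> \<bar>r\<bar>" "\<bar>r\<bar> \<le> g (max b M)" using b(1) b(2)[of "b/2"] M[of "max b M"] by auto
    show "continuous_on {b/2..max b M} g"
      unfolding g_def using b(1) by (intro continuous_intros) auto
  qed (use b in auto)
  then obtain \<tau> where \<tau>: "\<tau> \<ge> b/2" "g \<tau> = \<bar>r\<bar>" by auto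
  have pos: "\<tau> > 0" using \<tau> b by auto
  then have eq: "sinh (2 * \<tau>) - 2 * \<tau> = 8 * \<bar>r\<bar> * (sinh \<tau>)\<^sup>2"
    using \<tau>(2) by (simp add: g_def field_simps)
  \<comment> \<open>The ratio is odd in \<open>\<tau>\<close>, so a negative \<open>r\<close> is
    reached at \<open>-\<tau>\<close>.\<close>
  show ?thesis
  proof (cases "r > 0")
    case True
    then show ?thesis using that[of \<tau>] pos eq by simp
  next
    case False
    then show ?thesis using that[of "-\<tau>"] pos eq by simp
  qed
qed

text \<open>For \<open>c \<noteq> 0\<close> and \<open>\<tau> = c * t / 2\<close>, the addition
  formulas give \<open>x = (2 * sinh \<tau> / c) * cosh (\<psi> + \<tau>)\<close> and
  \<open>y = (2 * sinh \<tau> / c) * sinh (\<psi> + \<tau>)\<close>. Hence hyperbolic polar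
  coordinates \<open>\<rho>\<close>, \<open>\<eta>\<close> of the target determine \<open>c\<close>
  and \<open>\<psi>\<close> once \<open>\<tau>\<close> is known, and \<open>\<tau>\<close> is found
  from \<open>z\<close>.\<close>

lemma Exp_surj:
  assumes "0 < x" "4 * \<bar>z\<bar> < x\<^sup>2 - y\<^sup>2"
  shows "(x, y, z) \<in> Exp ` Exp_dom"
proof -
  define \<rho> where "\<rho> = sqrt (x\<^sup>2 - y\<^sup>2)"
  have rpos: "\<rho> > 0" and r2: "\<rho>\<^sup>2 = x\<^sup>2 - y\<^sup>2" using assms by (auto simp: \<rho>_def)
  define \<eta> where "\<eta> = arsinh (y / \<rho>)"
  have y: "y = \<rho> * sinh \<eta>" using rpos by (simp add: \<eta>_def)
  have "x\<^sup>2 = (\<rho> * cosh \<eta>)\<^sup>2"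
    using r2 y by (simp add: cosh_square_eq power_mult_distrib algebra_simps)
  then have x: "x = \<rho> * cosh \<eta>"
    using assms rpos by (simp add: power2_eq_iff_nonneg)
  show ?thesis
  proof (cases "z = 0")
    case True
    then show ?thesis
      using x y rpos by (auto simp: Exp_dom_def Exp_def image_iff intro!: bexI[of _ "(\<eta>, 0, \<rho>)"])
  next
    case False
    have "\<bar>z / \<rho>\<^sup>2\<bar> < 1/4" "z / \<rho>\<^sup>2 \<noteq> 0"
      using assms False rpos r2 by (auto simp: abs_div_pos[symmetric] field_simps)
    then obtain \<tau> where \<tau>: "\<tau> \<noteq> 0" "sinh (2 * \<tau>) - 2 * \<tau> = 8 * (z / \<rho>\<^sup>2) * (sinh \<tau>)\<^sup>2"
      by (rule sinh_area_ratio_surj)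
    define c where "c = 2 * sinh \<tau> / \<rho>"
    define t where "t = 2 * \<tau> / c"
    have s0: "sinh \<tau> \<noteq> 0" using \<tau> by simp
    have c0: "c \<noteq> 0" using s0 rpos by (simp add: c_def)
    have ct: "c * t = 2 * \<tau>" using c0 by (simp add: t_def)
    \<comment> \<open>\<open>c\<close> has the sign of \<open>\<tau>\<close>, which makes the time
      positive for either sign of \<open>z\<close>.\<close>
    have "\<tau> / sinh \<tau> > 0"
      using \<tau>(1) by (cases "\<tau> > 0") (auto simp: zero_less_divide_iff)
    moreover have "t = \<rho> * (\<tau> / sinh \<tau>)" by (simp add: t_def c_def)
    ultimately have "t > 0" using rpos by (simp only: mult_pos_pos)
    have e: "\<eta> - \<tau> + c * t = \<eta> + \<tau>" using ct by simp
    have "(sinh (\<eta> + \<tau>) - sinh (\<eta> - \<tau>)) / c = x"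
      using s0 rpos by (simp add: sinh_add sinh_diff c_def x field_simps)
    moreover have "(cosh (\<eta> + \<tau>) - cosh (\<eta> - \<tau>)) / c = y"
      using s0 rpos by (simp add: cosh_add cosh_diff c_def y field_simps)
    moreover have "(sinh (2 * \<tau>) - 2 * \<tau>) / (2 * c\<^sup>2) = z"
      unfolding \<tau>(2) c_def using s0 rpos by (simp add: field_simps)
    ultimately have "Exp (\<eta> - \<tau>, c, t) = (x, y, z)"
      unfolding Exp_def prod.case e ct using c0 by (simp add: add.commute)
    then show ?thesis using \<open>t > 0\<close> by (intro rev_image_eqI[of "(\<eta> - \<tau>, c, t)"]) (auto simp: Exp_dom_def)
  qed
qed

section \<open>Coordinates and velocities of the extremals\<close>

lemma sqrt_one_plus_sinh_square: "sqrt (1 + (sinh x)\<^sup>2) = cosh (x :: real)"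
  by (rule real_sqrt_unique) (auto simp: cosh_square_eq)

lemma Exp_at_0: "Exp (\<psi>, c, 0) = q0"
  by (simp add: Exp_def q0_def)

text \<open>Absorbs the case split on \<open>c\<close>. The last identity is the link to the
  calibration: along an extremal the second control is an affine function of \<open>x\<close>, so
  the extremal follows the field \<open>(sqrt (1 + w\<^sup>2), w)\<close>.\<close>

lemma Exp_components:
  obtains x y z :: "real \<Rightarrow> real"
  where "\<And>t. Exp (\<psi>, c, t) = (x t, y t, z t)"
    and "\<And>t. (x has_real_derivative cosh (\<psi> + c * t)) (at t)"
    and "\<And>t. (y has_real_derivative sinh (\<psi> + c * t)) (at t)"
    and "\<And>t. (z has_real_derivative
        (x t * sinh (\<psi> + c * t) - y t * cosh (\<psi> + c * t)) / 2) (at t)"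
    and "\<And>t. sinh \<psi> + c * x t = sinh (\<psi> + c * t)"
proof (cases "c = 0")
  case True
  show ?thesis
    by (rule that[of "\<lambda>t. t * cosh \<psi>" "\<lambda>t. t * sinh \<psi>" "\<lambda>t. 0"])
      (auto simp: True Exp_def intro!: derivative_eq_intros)
next
  case False
  show ?thesis
  proof (rule that[of "\<lambda>t. (sinh (\<psi> + c * t) - sinh \<psi>) / c" "\<lambda>t. (cosh (\<psi> + c * t) - cosh \<psi>) / c"
        "\<lambda>t. (sinh (c * t) - c * t) / (2 * c\<^sup>2)"])
    fix t
    define a where "a = \<psi> + c * t"
    \<comment> \<open>Writing \<open>c * t\<close> as the difference of \<open>a\<close> and
      \<open>\<psi>\<close> brings the derivative of \<open>z\<close> into the form required by
      horizontality.\<close>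
    have ct: "cosh (c * t) = cosh a * cosh \<psi> - sinh a * sinh \<psi>"
      using cosh_diff[of a \<psi>] by (simp add: a_def)
    have a1: "sinh a * sinh a = cosh a * cosh a - 1"
      using hyperbolic_pythagoras[of a] by (simp add: power2_eq_square)
    have "((\<lambda>t. (sinh (c * t) - c * t) / (2 * c\<^sup>2)) has_real_derivative (cosh (c * t) - 1) / (2 * c)) (at t)"
      using False by (auto intro!: derivative_eq_intros simp: field_simps power2_eq_square)
    moreover have "(cosh (c * t) - 1) / (2 * c) =
      ((sinh a - sinh \<psi>) / c * sinh a - (cosh a - cosh \<psi>) / c * cosh a) / 2"
    proof -
      have "cosh (c * t) - 1 = (sinh a - sinh \<psi>) * sinh a - (cosh a - cosh \<psi>) * cosh a"
        using a1 by (simp add: ct algebra_simps)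
      then show ?thesis using False by (simp only:) (simp add: field_simps)
    qed
    ultimately show "((\<lambda>t. (sinh (c * t) - c * t) / (2 * c\<^sup>2)) has_real_derivative
      ((sinh (\<psi> + c * t) - sinh \<psi>) / c * sinh (\<psi> + c * t) -
       (cosh (\<psi> + c * t) - cosh \<psi>) / c * cosh (\<psi> + c * t)) / 2) (at t)"
      by (simp add: a_def)
  qed (use False in \<open>auto simp: Exp_def intro!: derivative_eq_intros\<close>)
qed

lemma Exp_admissible:
  assumes "0 \<le> T"
  shows "admissible (Exp (\<psi>, c, T)) T (\<lambda>t. Exp (\<psi>, c, t))"
proof -
  obtain x y z :: "real \<Rightarrow> real"
  where E: "\<And>t. Exp (\<psi>, c, t) = (x t, y t, z t)"
    and d: "\<And>t. (x has_real_derivative cosh (\<psi> + c * t)) (at t)"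
    "\<And>t. (y has_real_derivative sinh (\<psi> + c * t)) (at t)"
    "\<And>t. (z has_real_derivative (x t * sinh (\<psi> + c * t) - y t * cosh (\<psi> + c * t)) / 2) (at t)"
    by (rule Exp_components[of \<psi> c]) blast
  define v where "v t = (cosh (\<psi> + c * t), sinh (\<psi> + c * t),
      (x t * sinh (\<psi> + c * t) - y t * cosh (\<psi> + c * t)) / 2)" for t
  have "((\<lambda>t. Exp (\<psi>, c, t)) has_vector_derivative v t) (at t)" for t
    unfolding E v_def
    by (intro has_vector_derivative_Pair; use d[of t] in \<open>simp add: has_real_derivative_iff_has_vector_derivative\<close>)
  then have dE: "((\<lambda>t. Exp (\<psi>, c, t)) has_vector_derivative v t) (at t within {0..T})" for t
    by (rule has_vector_derivative_at_within)
  have "continuous_on {0..T} x" "continuous_on {0..T} y"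
    using d(1,2) by (meson DERIV_isCont continuous_at_imp_continuous_on)+
  then have "continuous_on {0..T} v"
    unfolding v_def by (intro continuous_intros) auto
  with dE have "\<exists>L. L-lipschitz_on {0..T} (\<lambda>t. Exp (\<psi>, c, t))"
    by (intro C1_imp_lipschitz_on_interval[where f'=v]) auto
  moreover have "v t = cosh (\<psi> + c * t) *\<^sub>R X1 (Exp (\<psi>, c, t)) + sinh (\<psi> + c * t) *\<^sub>R X2 (Exp (\<psi>, c, t))" for t
    by (simp add: v_def E X1_def X2_def field_simps)
  ultimately have "trajectory {(u1, u2). u1\<^sup>2 - u2\<^sup>2 = 1 \<and> u1 > 0} T (\<lambda>t. Exp (\<psi>, c, t))"
    unfolding trajectory_def using dE
    by (intro conjI exI[of _ "\<lambda>t. cosh (\<psi> + c * t)"] exI[of _ "\<lambda>t. sinh (\<psi> + c * t)"])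
      (auto simp: hyperbolic_pythagoras)
  then show ?thesis using assms by (simp add: admissible_def Exp_at_0)
qed

subsection \<open>Calibration\<close>

lemma arsinh_affine_has_real_derivative:
  fixes s c x :: real
  shows "((\<lambda>x. arsinh (s + c * x)) has_real_derivative c / sqrt (1 + (s + c * x)\<^sup>2)) (at x)"
proof -
  have "((\<lambda>x. s + c * x) has_real_derivative c) (at x)"
    by (auto intro!: derivative_eq_intros)
  from DERIV_chain2[OF arsinh_real_has_field_derivative this] show ?thesis
    by (simp add: add.commute[of 1])
qed

text \<open>Supplies the primitive of the \<open>dx\<close> part of the calibrating form: the
  classical primitive of \<open>sqrt (1 + w\<^sup>2)\<close> in \<open>w\<close>, divided by
  \<open>c\<close>, hence the separate case \<open>c = 0\<close>.\<close>

lemma antiderivative_sqrt_one_plus_affine_square: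
  fixes s c :: real
  obtains F where "\<And>x. (F has_real_derivative sqrt (1 + (s + c * x)\<^sup>2)) (at x)"
proof (cases "c = 0")
  case True
  then show ?thesis
    using that[of "\<lambda>x. sqrt (1 + s\<^sup>2) * x"] by (auto intro!: derivative_eq_intros)
next
  case False
  have "((\<lambda>x. ((s + c * x) * sqrt (1 + (s + c * x)\<^sup>2) + arsinh (s + c * x)) / (2 * c))
      has_real_derivative sqrt (1 + (s + c * x)\<^sup>2)) (at x)" for x
  proof -
    define w where "w = s + c * x"
    have pos: "0 < 1 + w\<^sup>2" by (simp add: add_pos_nonneg)
    define R where "R = sqrt (1 + w\<^sup>2)"
    have R: "R > 0" "R * R = 1 + w\<^sup>2" using pos by (auto simp: R_def)
    have dw: "((\<lambda>x. s + c * x) has_real_derivative c) (at x)"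
      by (auto intro!: derivative_eq_intros)
    have dR: "((\<lambda>x. sqrt (1 + (s + c * x)\<^sup>2)) has_real_derivative c * w / R) (at x)"
      using pos R by (auto intro!: derivative_eq_intros simp flip: w_def simp: R_def field_simps)
    have dA: "((\<lambda>x. arsinh (s + c * x)) has_real_derivative c / R) (at x)"
      using arsinh_affine_has_real_derivative by (simp add: R_def w_def)
    have "(w * (c * w / R) + c * R + c / R) / (2 * c) = R"
      using False R(1) arg_cong[OF R(2), of "(*) c"] by (simp add: field_simps power2_eq_square)
    then show ?thesis
      using DERIV_cdivide[OF DERIV_add[OF DERIV_mult[OF dw dR] dA], of "2 * c"]
      by (simp add: w_def R_def algebra_simps)
  qed
  then show ?thesis by (rule that)
qed

text \<open>Both \<open>(a, w)\<close>, with \<open>a = sqrt (1 + w\<^sup>2)\<close>, and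
  \<open>(u1, u2)\<close> lie on the same branch of the unit hyperbola. The square of their
  Lorentzian product is 1 plus the square of \<open>a * u2 - w * u1\<close>, and the common branch
  makes the product positive. Equality kills the cross term.\<close>

lemma hyperbolic_reverse_Cauchy_Schwarz:
  fixes w u1 u2 :: real
  assumes "u1\<^sup>2 - u2\<^sup>2 = 1" "u1 > 0"
  shows "1 \<le> sqrt (1 + w\<^sup>2) * u1 - w * u2"
    and "sqrt (1 + w\<^sup>2) * u1 - w * u2 = 1 \<Longrightarrow> u1 = sqrt (1 + w\<^sup>2) \<and> u2 = w"
proof -
  define a where "a = sqrt (1 + w\<^sup>2)"
  have a: "a > 0" "a\<^sup>2 = 1 + w\<^sup>2" by (auto simp: a_def add_pos_nonneg)
  have id: "(a * u1 - w * u2)\<^sup>2 = 1 + (a * u2 - w * u1)\<^sup>2"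
  proof -
    have "(a * u1 - w * u2)\<^sup>2 - (a * u2 - w * u1)\<^sup>2 = (a\<^sup>2 - w\<^sup>2) * (u1\<^sup>2 - u2\<^sup>2)"
      by (simp add: power2_eq_square algebra_simps)
    then show ?thesis using a assms by simp
  qed
  have "\<bar>w\<bar> < a" "\<bar>u2\<bar> < u1"
    using power2_less_imp_less[of "\<bar>w\<bar>" a] power2_less_imp_less[of "\<bar>u2\<bar>" u1] a assms by simp_all
  then have "\<bar>w\<bar> * \<bar>u2\<bar> < a * u1" by (intro mult_strict_mono) auto
  then have pos: "0 < a * u1 - w * u2"
    using abs_ge_self[of "w * u2"] by (simp add: abs_mult)
  have "(1::real)\<^sup>2 \<le> (a * u1 - w * u2)\<^sup>2" using id by simp
  then show "1 \<le> sqrt (1 + w\<^sup>2) * u1 - w * u2"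
    using power2_le_imp_le[OF _ less_imp_le[OF pos]] unfolding a_def[symmetric] by blast
  assume "sqrt (1 + w\<^sup>2) * u1 - w * u2 = 1"
  then have e: "a * u1 = 1 + w * u2" "a * u2 = w * u1"
    using id by (auto simp: a_def[symmetric])
  \<comment> \<open>The two equations are linear in \<open>u1\<close> and \<open>u2\<close> with
    determinant \<open>a\<^sup>2 - w\<^sup>2 = 1\<close>; multiplying by \<open>a\<close> performs
    the elimination.\<close>
  have "a\<^sup>2 * u1 = a + w * (a * u2)" "a\<^sup>2 * u2 = w * (a * u1)"
    using arg_cong[OF e(1), of "(*) a"] arg_cong[OF e(2), of "(*) a"]
    by (simp_all add: power2_eq_square algebra_simps)
  then have "(1 + w\<^sup>2) * u1 = a + w * (w * u1)" "(1 + w\<^sup>2) * u2 = w * (1 + w * u2)"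
    unfolding e a(2) .
  then have "u1 = a" "u2 = w" by (simp_all add: power2_eq_square algebra_simps)
  then show "u1 = sqrt (1 + w\<^sup>2) \<and> u2 = w" by (simp add: a_def)
qed

text \<open>\<open>G\<close> is the potential of the calibrating form for one fixed pair
  \<open>\<psi>\<close>, \<open>c\<close>: it measures time exactly on that extremal and bounds the
  time of every competitor, so equality identifies the curve.\<close>

lemma admissible_calibration:
  fixes \<psi> c :: real
  obtains G :: "point \<Rightarrow> real"
  where "\<And>t. G (Exp (\<psi>, c, t)) = t"
    and "\<And>q1 T q. admissible q1 T q \<Longrightarrow> T \<le> G q1"
    and "\<And>T q t. admissible (q T) T q \<Longrightarrow> G (q T) = T \<Longrightarrow> t \<in> {0..T} \<Longrightarrow> q t = Exp (\<psi>, c, t)"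
proof -
  define W where "W x = sqrt (1 + (sinh \<psi> + c * x)\<^sup>2)" for x
  obtain F where F: "\<And>x. (F has_real_derivative W x) (at x)"
    unfolding W_def by (rule antiderivative_sqrt_one_plus_affine_square[of "sinh \<psi>" c]) blast
  \<comment> \<open>Here \<open>w dy\<close> is \<open>sinh \<psi> dy + c x dy\<close>, and
    \<open>x dy\<close> integrates to \<open>z + x * y / 2\<close> along horizontal curves;
    subtracting \<open>F 0\<close> makes \<open>G\<close> vanish at \<open>q0\<close>.\<close>
  define G :: "point \<Rightarrow> real" where
    "G = (\<lambda>(x, y, z). F x - F 0 - (sinh \<psi> * y + c * (z + x * y / 2)))"
  have G_deriv: "((\<lambda>t. G (x t, y t, z t) - t) has_real_derivative
      W (x t) * u1 - (sinh \<psi> + c * x t) * u2 - 1) (at t within S)"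
    if "(x has_real_derivative u1) (at t within S)" "(y has_real_derivative u2) (at t within S)"
      "(z has_real_derivative (x t * u2 - y t * u1) / 2) (at t within S)" for x y z u1 u2 t S
    unfolding G_def prod.case
    by (rule derivative_eq_intros DERIV_chain2[OF F] that refl | simp add: field_simps)+
  obtain xe ye ze :: "real \<Rightarrow> real"
  where E: "\<And>t. Exp (\<psi>, c, t) = (xe t, ye t, ze t)"
    and dE: "\<And>t. (xe has_real_derivative cosh (\<psi> + c * t)) (at t)"
    "\<And>t. (ye has_real_derivative sinh (\<psi> + c * t)) (at t)"
    "\<And>t. (ze has_real_derivative (xe t * sinh (\<psi> + c * t) - ye t * cosh (\<psi> + c * t)) / 2) (at t)"
    and wE: "\<And>t. sinh \<psi> + c * xe t = sinh (\<psi> + c * t)"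
    by (rule Exp_components[of \<psi> c]) blast
  have cosh_W: "W (xe t) = cosh (\<psi> + c * t)" for t
    by (simp add: W_def wE sqrt_one_plus_sinh_square)
  have G0: "G q0 = 0" by (simp add: G_def q0_def)
  have GE: "G (Exp (\<psi>, c, t)) = t" for t
  proof -
    have "((\<lambda>t. G (Exp (\<psi>, c, t)) - t) has_real_derivative 0) (at t)" for t
      using G_deriv[OF dE, of t] hyperbolic_pythagoras[of "\<psi> + c * t"]
      by (simp add: E cosh_W wE power2_eq_square)
    then have "G (Exp (\<psi>, c, t)) - t = G (Exp (\<psi>, c, 0)) - 0"
      by (intro DERIV_isconst_all) auto
    then show ?thesis by (simp add: Exp_at_0 G0)
  qed
  have main: "T \<le> G q1 \<and> (G q1 = T \<longrightarrow> (\<forall>t\<in>{0..T}. q t = Exp (\<psi>, c, t)))"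
    if adm: "admissible q1 T q" for q1 T q
  proof -
    have T0: "0 \<le> T" and ends: "q 0 = q0" "q T = q1"
      and tr: "trajectory {(u1, u2). u1\<^sup>2 - u2\<^sup>2 = 1 \<and> u1 > 0} T q"
      using adm by (auto simp: admissible_def)
    from tr obtain x y z u1 u2 where q: "\<And>t. q t = (x t, y t, z t)"
      and lip: "\<exists>L. L-lipschitz_on {0..T} x" "\<exists>L. L-lipschitz_on {0..T} y" "\<exists>L. L-lipschitz_on {0..T} z"
      and "AE t in lebesgue_on {0..T}. (u1 t, u2 t) \<in> {(u1, u2). u1\<^sup>2 - u2\<^sup>2 = 1 \<and> u1 > 0} \<and>
        (x has_real_derivative u1 t) (at t within {0..T}) \<and>
        (y has_real_derivative u2 t) (at t within {0..T}) \<and>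
        (z has_real_derivative (x t * u2 t - y t * u1 t) / 2) (at t within {0..T})"
      by (rule trajectoryE) blast
    then have ae: "AE t in lebesgue_on {0..T}. ((u1 t)\<^sup>2 - (u2 t)\<^sup>2 = 1 \<and> u1 t > 0) \<and>
        (x has_real_derivative u1 t) (at t within {0..T}) \<and>
        (y has_real_derivative u2 t) (at t within {0..T}) \<and>
        (z has_real_derivative (x t * u2 t - y t * u1 t) / 2) (at t within {0..T})"
      by simp
    have init: "x 0 = 0" "y 0 = 0" "z 0 = 0"
      using ends q by (auto simp: q0_def)
    \<comment> \<open>\<open>H\<close> is the excess of the potential over elapsed time. Its
      derivative is the defect in the reverse Cauchy-Schwarz inequality, so \<open>H\<close>
      increases from 0, and \<open>H T = 0\<close> forces the defect to vanish almost
      everywhere.\<close>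
    define H where "H t = G (q t) - t" for t
    have H_deriv: "AE t in lebesgue_on {0..T}.
      (H has_real_derivative W (x t) * u1 t - (sinh \<psi> + c * x t) * u2 t - 1) (at t within {0..T})"
      using ae unfolding H_def[abs_def] q by (rule eventually_mono) (auto intro!: G_deriv)
    have contW: "continuous_on UNIV W"
      unfolding W_def by (intro continuous_intros)
    have "\<exists>L. L-lipschitz_on {0..T} H"
    proof -
      obtain L1 L2 L3 L4 where L:
        "L1-lipschitz_on {0..T} (\<lambda>t. F (x t))" "L2-lipschitz_on {0..T} y"
        "L3-lipschitz_on {0..T} z" "L4-lipschitz_on {0..T} (\<lambda>t. x t * y t)"
        using lipschitz_on_C1_compose[OF lip(1) compact_Icc F contW] lip(2,3)
          lipschitz_on_mult_compact[OF lip(1,2) compact_Icc] by blast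
      have H_eq: "H = (\<lambda>t. F (x t) - F 0 - (sinh \<psi> * y t + c * (z t + 1/2 * (x t * y t))) - t)"
        by (auto simp: H_def G_def q)
      show ?thesis
        unfolding H_eq
        by (rule exI) (rule lipschitz_on_diff[OF lipschitz_on_diff[OF lipschitz_on_diff[OF L(1) lipschitz_on_constant]
          lipschitz_on_add[OF lipschitz_on_cmult_real[OF L(2)] lipschitz_on_cmult_real[OF
          lipschitz_on_add[OF L(3) lipschitz_on_cmult_real[OF L(4)]]]]] lipschitz_on_id])
    qed
    then obtain LH where "LH-lipschitz_on {0..T} H" by blast
    moreover have "AE t in lebesgue_on {0..T}. \<exists>d\<ge>0. (H has_real_derivative d) (at t within {0..T})"
      using ae H_deriv
    proof eventually_elim
      case (elim t)
      then show ?case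
        using hyperbolic_reverse_Cauchy_Schwarz(1)[of "u1 t" "u2 t" "sinh \<psi> + c * x t"]
        by (intro exI[of _ "W (x t) * u1 t - (sinh \<psi> + c * x t) * u2 t - 1"]) (auto simp: W_def)
    qed
    ultimately have mono: "mono_on {0..T} H"
      by (rule lipschitz_AE_nonneg_derivative_imp_mono)
    have H0: "H 0 = 0" by (simp add: H_def ends G0)
    have "T \<le> G q1" using mono_onD[OF mono, of 0 T] T0 H0 ends by (simp add: H_def)
    moreover have "q t = Exp (\<psi>, c, t)" if eq: "G q1 = T" and t: "t \<in> {0..T}" for t
    \<comment> \<open>On a degenerate interval derivatives are not unique, so the constant curve is
      treated apart.\<close>
    proof (cases "T = 0")
      case True
      then show ?thesis using t ends by (simp add: Exp_at_0)
    next
      case False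
      with T0 have T: "0 < T" by simp
      have HT: "H 0 = H T" using H0 eq ends by (simp add: H_def)
      have "AE t in lebesgue_on {0..T}. t \<in> {0..T}"
        by (rule AE_I2) simp
      with ae H_deriv have ae2: "AE t in lebesgue_on {0..T}.
        (u1 t = W (x t) \<and> u2 t = sinh \<psi> + c * x t) \<and>
        (x has_real_derivative u1 t) (at t within {0..T}) \<and>
        (y has_real_derivative u2 t) (at t within {0..T}) \<and>
        (z has_real_derivative (x t * u2 t - y t * u1 t) / 2) (at t within {0..T})"
      proof eventually_elim
        case (elim t)
        then have "W (x t) * u1 t - (sinh \<psi> + c * x t) * u2 t - 1 = 0"
          using mono_on_eq_ends_derivative_zero[OF mono HT T] by blast
        then show ?case
          using elim hyperbolic_reverse_Cauchy_Schwarz(2)[of "u1 t" "u2 t" "sinh \<psi> + c * x t"]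
          by (auto simp: W_def)
      qed
      have lip_arsinh: "\<exists>L. L-lipschitz_on {0..T} (\<lambda>t. arsinh (sinh \<psi> + c * x t))"
      proof (rule lipschitz_on_C1_compose[OF lip(1) compact_Icc])
        show "((\<lambda>x. arsinh (sinh \<psi> + c * x)) has_real_derivative c / W x) (at x)" for x
          unfolding W_def by (rule arsinh_affine_has_real_derivative)
        have "W x \<noteq> 0" for x by (simp add: W_def add_pos_nonneg less_imp_neq[symmetric])
        then show "continuous_on UNIV (\<lambda>x. c / W x)"
          using contW by (intro continuous_intros) auto
      qed
      then obtain La where La: "La-lipschitz_on {0..T} (\<lambda>t. arsinh (sinh \<psi> + c * x t))" by blast
      have Lb: "(0 + \<bar>c\<bar> * 1)-lipschitz_on {0..T} (\<lambda>t. \<psi> + c * t)"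
        by (intro lipschitz_on_add lipschitz_on_constant lipschitz_on_cmult_real lipschitz_on_id)
      \<comment> \<open>The curve satisfies \<open>x' = W x\<close> only almost everywhere. The
        substitution by \<open>arsinh\<close> straightens this equation: the derivative is
        \<open>c / W (x t) * u1 t\<close>, which is the constant \<open>c\<close> because
        \<open>u1 t = W (x t)\<close>.\<close>
      have rapidity: "arsinh (sinh \<psi> + c * x t) = \<psi> + c * t" if "t \<in> {0..T}" for t
      proof (rule lipschitz_AE_eq_derivative_imp_eq[OF La Lb _ _ that])
        show "arsinh (sinh \<psi> + c * x 0) = \<psi> + c * 0"
          by (simp add: init arsinh_sinh_real)
        show "AE t in lebesgue_on {0..T}. \<exists>d. ((\<lambda>t. arsinh (sinh \<psi> + c * x t)) has_real_derivative d)
            (at t within {0..T}) \<and> ((\<lambda>t. \<psi> + c * t) has_real_derivative d) (at t within {0..T})"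
          using ae2
        proof eventually_elim
          case (elim t)
          have "W (x t) > 0" by (simp add: W_def add_pos_nonneg)
          moreover have "((\<lambda>t. arsinh (sinh \<psi> + c * x t)) has_real_derivative c / W (x t) * u1 t)
              (at t within {0..T})"
            unfolding W_def using elim by (intro DERIV_chain2[OF arsinh_affine_has_real_derivative]) blast
          ultimately have "((\<lambda>t. arsinh (sinh \<psi> + c * x t)) has_real_derivative c) (at t within {0..T})"
            using elim by simp
          moreover have "((\<lambda>t. \<psi> + c * t) has_real_derivative c) (at t within {0..T})"
            by (auto intro!: derivative_eq_intros)
          ultimately show ?case by blast
        qed
      qed
      have w: "sinh \<psi> + c * x t = sinh (\<psi> + c * t)" if "t \<in> {0..T}" for t
        using rapidity[OF that] sinh_arsinh_real by metis
      have W: "W (x t) = cosh (\<psi> + c * t)" if "t \<in> {0..T}" for t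
        by (simp add: W_def w[OF that] sqrt_one_plus_sinh_square)
      have "AE t in lebesgue_on {0..T}. t \<in> {0..T}"
        by (rule AE_I2) simp
      with ae2 have ae3: "AE t in lebesgue_on {0..T}. t \<in> {0..T} \<and>
        (x has_real_derivative cosh (\<psi> + c * t)) (at t within {0..T}) \<and>
        (y has_real_derivative sinh (\<psi> + c * t)) (at t within {0..T}) \<and>
        (z has_real_derivative (x t * sinh (\<psi> + c * t) - y t * cosh (\<psi> + c * t)) / 2) (at t within {0..T})"
        by eventually_elim (auto simp: w W)
      note dE' = dE[THEN has_field_derivative_at_within]
      have init_E: "xe 0 = 0" "ye 0 = 0" "ze 0 = 0"
        using E[of 0] by (auto simp: Exp_at_0 q0_def)
      have contE: "continuous_on {0..T} xe" "continuous_on {0..T} ye"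
        using dE(1,2) by (meson DERIV_isCont continuous_at_imp_continuous_on)+
      have "\<exists>L. L-lipschitz_on {0..T} xe" "\<exists>L. L-lipschitz_on {0..T} ye" "\<exists>L. L-lipschitz_on {0..T} ze"
        by (rule DERIV_continuous_imp_lipschitz_on_interval, rule dE, intro continuous_intros contE; simp)+
      moreover note lip
      ultimately obtain L1 L2 L3 M1 M2 M3 where L:
        "L1-lipschitz_on {0..T} x" "L2-lipschitz_on {0..T} y" "L3-lipschitz_on {0..T} z"
        "M1-lipschitz_on {0..T} xe" "M2-lipschitz_on {0..T} ye" "M3-lipschitz_on {0..T} ze"
        by blast
      have X: "x t = xe t" if "t \<in> {0..T}" for t
      proof (rule lipschitz_AE_eq_derivative_imp_eq[OF L(1,4) _ _ that])
        show "AE t in lebesgue_on {0..T}. \<exists>d. (x has_real_derivative d) (at t within {0..T}) \<and>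
            (xe has_real_derivative d) (at t within {0..T})"
          using ae3 by (rule eventually_mono) (intro exI conjI, elim conjE, assumption, rule dE')
      qed (use init init_E in simp)
      have Y: "y t = ye t" if "t \<in> {0..T}" for t
      proof (rule lipschitz_AE_eq_derivative_imp_eq[OF L(2,5) _ _ that])
        show "AE t in lebesgue_on {0..T}. \<exists>d. (y has_real_derivative d) (at t within {0..T}) \<and>
            (ye has_real_derivative d) (at t within {0..T})"
          using ae3 by (rule eventually_mono) (intro exI conjI, elim conjE, assumption, rule dE')
      qed (use init init_E in simp)
      \<comment> \<open>The derivative of \<open>z\<close> contains \<open>x\<close> and
        \<open>y\<close>, so it matches that of \<open>ze\<close> only after these have been
        identified.\<close>
      have Z: "z t = ze t" if "t \<in> {0..T}" for t
      proof (rule lipschitz_AE_eq_derivative_imp_eq[OF L(3,6) _ _ that])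
        show "AE t in lebesgue_on {0..T}. \<exists>d. (z has_real_derivative d) (at t within {0..T}) \<and>
            (ze has_real_derivative d) (at t within {0..T})"
          using ae3
        proof eventually_elim
          case (elim t)
          then have "(z has_real_derivative (xe t * sinh (\<psi> + c * t) - ye t * cosh (\<psi> + c * t)) / 2)
              (at t within {0..T})"
            using X[of t] Y[of t] by simp
          then show ?case by (intro exI conjI) (assumption, rule dE')
        qed
      qed (use init init_E in simp)
      show ?thesis using X[OF t] Y[OF t] Z[OF t] by (simp add: q E)
    qed
    ultimately show ?thesis by blast
  qed
  show ?thesis
  proof (rule that[of G])
    show "G (Exp (\<psi>, c, t)) = t" for t by (rule GE)
    show "T \<le> G q1" if "admissible q1 T q" for q1 T q using main[OF that] by blast
    show "q t = Exp (\<psi>, c, t)" if "admissible (q T) T q" "G (q T) = T" "t \<in> {0..T}" for T q t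
      using main[OF that(1)] that by blast
  qed
qed

section \<open>Optimality and uniqueness of the extremal\<close>

theorem theorem5:
  fixes q1 :: point and \<psi> c t1 :: real
  assumes "q1 \<in> chronological_future q0"
    and "(\<psi>, c, t1) = inv_into Exp_dom Exp q1"
  shows "(\<psi>, c, t1) \<in> Exp_dom \<and>
    optimal q1 t1 (\<lambda>t. Exp (\<psi>, c, t)) \<and>
    (\<forall>T q. optimal q1 T q \<longrightarrow> T = t1 \<and> (\<forall>t\<in>{0..t1}. q t = Exp (\<psi>, c, t)))"
proof -
  obtain x1 y1 z1 where q1: "q1 = (x1, y1, z1)" by (cases q1)
  \<comment> \<open>Membership in the image is what makes \<open>inv_into\<close> return a genuine
    preimage rather than an unspecified value.\<close>
  have "q1 \<in> Exp ` Exp_dom"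
    using chronological_future_q0_subset[of x1 y1 z1] Exp_surj[of x1 z1 y1] assms(1) by (simp add: q1)
  then have dom: "(\<psi>, c, t1) \<in> Exp_dom" and E: "Exp (\<psi>, c, t1) = q1"
    using inv_into_into[of q1 Exp Exp_dom] f_inv_into_f[of q1 Exp Exp_dom] assms(2) by auto
  have t1: "0 < t1" using dom by (simp add: Exp_dom_def)
  obtain G :: "point \<Rightarrow> real" where G: "\<And>t. G (Exp (\<psi>, c, t)) = t"
    "\<And>q1 T q. admissible q1 T q \<Longrightarrow> T \<le> G q1"
    "\<And>T q t. admissible (q T) T q \<Longrightarrow> G (q T) = T \<Longrightarrow> t \<in> {0..T} \<Longrightarrow> q t = Exp (\<psi>, c, t)"
    by (rule admissible_calibration[of \<psi> c]) blast
  have Gq1: "G q1 = t1" using G(1)[of t1] E by simp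
  have opt: "optimal q1 t1 (\<lambda>t. Exp (\<psi>, c, t))"
    unfolding optimal_def using Exp_admissible[of t1 \<psi> c] t1 E G(2)[of q1] Gq1 by auto
  have "T = t1 \<and> (\<forall>t\<in>{0..t1}. q t = Exp (\<psi>, c, t))" if "optimal q1 T q" for T q
  proof -
    \<comment> \<open>Two optimal trajectories bound each other's time, so any optimal
      \<open>q\<close> attains \<open>G q1 = T\<close>, the equality case of the
      calibration.\<close>
    have T: "T = t1" and adm: "admissible q1 T q"
      using that opt by (auto simp: optimal_def intro: antisym)
    then have "q T = q1" by (simp add: admissible_def)
    then show ?thesis using G(3)[of q T] adm T Gq1 by auto
  qed
  with dom opt show ?thesis by blast
qed

end
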